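(* Let $P,Q\in\mathbb Z$ with $Q=\pm1$ and $\Delta=P^2+4Q>0$, and assume the Lucas sequence $U_n=U_n(P,Q)$ is nondegenerate. Let $A\in\mathbb Z\setminus\{0\}$, let $r\ge1$, and suppose that $n_1,\ldots,n_r$ are pairwise coprime positive integers. If $$A y^2=\prod_{i=1}^r U_{n_i}(P,Q)$$ for some $y\in\mathbb Z$, then for every $i$ there exist a signed squarefree integer $e_i$ and an integer $s_i$ such that $$U_{n_i}=e_i s_i^2,\qquad |e_i|\mid \operatorname{rad}(A).$$ Equivalently, for every $i$ one has $[U_{n_i}(P,Q)]\in G_A$, where $G_A=\langle -1,\ p: p\mid A\rangle\subset \mathbb Q^\times/(\mathbb Q^\times)^2$.
   Context: The Lucas sequence $U_n=U_n(P,Q)$ is defined by $U_0=0$, $U_1=1$, $U_{n+2}=PU_{n+1}+QU_n$ (note the sign convention for $Q$). Let $\alpha,\beta$ be the roots of $x^2-Px-Q$. The sequence is nondegenerate if $\alpha/\beta$ is not a root of unity (then $U_n\ne0$ for all $n\ge1$). A signed squarefree integer is a nonzero integer, possibly negative, divisible by the square of no rational prime ($\pm1$ allowed). $\operatorname{rad}(A)$ is the product of the distinct primes dividing $A$. $[x]$ denotes the class of $x\in\mathbb Q^\times$ in $\mathbb Q^\times/(\mathbb Q^\times)^2$, and $G_A$ is the subgroup generated by the classes of $-1$ and of the rational primes $p$ dividing $A$. *)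

theory Defs
  imports
    "HOL-Computational_Algebra.Computational_Algebra"
    "HOL-Algebra.Coset"
    "HOL-Algebra.Generated_Groups"
    Complex_Main
begin

fun lucasU :: "int \<Rightarrow> int \<Rightarrow> nat \<Rightarrow> int" where
  "lucasU P Q 0 = 0"
| "lucasU P Q (Suc 0) = 1"
| "lucasU P Q (Suc (Suc n)) = P * lucasU P Q (Suc n) + Q * lucasU P Q n"

text \<open>The pair of roots of \<open>x\<^sup>2 - P x - Q\<close>, with multiplicity, is encoded by the factorisation
  \<open>x\<^sup>2 - P x - Q = (x - \<alpha>) (x - \<beta>)\<close> over the complex numbers.  Such a factorisation always
  exists and is unique up to swapping \<open>\<alpha>\<close> and \<open>\<beta>\<close>.  For \<open>Q \<noteq> 0\<close> both roots are nonzero, so the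
  quotient is a genuine one.\<close>

definition lucas_nondegenerate :: "int \<Rightarrow> int \<Rightarrow> bool" where
  "lucas_nondegenerate P Q \<longleftrightarrow>
     (\<forall>\<alpha> \<beta> :: complex.
        [:- of_int Q, - of_int P, 1:] = [:- \<alpha>, 1:] * [:- \<beta>, 1:] \<longrightarrow>
        \<not> (\<exists>k::nat. k > 0 \<and> (\<alpha> / \<beta>) ^ k = 1))"

definition rad :: "int \<Rightarrow> int" where
  "rad A = \<Prod>(prime_factors A)"

definition rat_units :: "rat monoid" where
  "rat_units = \<lparr>carrier = UNIV - {0}, mult = (*), one = 1\<rparr>"

definition rat_squares :: "rat set" where
  "rat_squares = {x ^ 2 | x. x \<in> carrier rat_units}"

definition sqclass_group :: "rat set monoid" where
  "sqclass_group = rat_units Mod rat_squares"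

definition sqclass :: "rat \<Rightarrow> rat set" where
  "sqclass x = rat_squares #>\<^bsub>rat_units\<^esub> x"

definition G_sub :: "int \<Rightarrow> rat set set" where
  "G_sub A = generate sqclass_group
     ({sqclass (- 1)} \<union> {sqclass (of_int p) | p. prime p \<and> p dvd A})"

lemma comm_group_rat_units: "comm_group rat_units"
  by (rule comm_groupI) (auto simp: rat_units_def intro!: exI[of _ "inverse _"] bexI[of _ "inverse _"])

lemma rat_squares_normal: "rat_squares \<lhd> rat_units"
proof -
  interpret comm_group rat_units by (rule comm_group_rat_units)
  have inv_eq: "inv\<^bsub>rat_units\<^esub> x = inverse x" if "x \<noteq> 0" for x
    using that by (intro inv_equality) (auto simp: rat_units_def)
  have "subgroup rat_squares rat_units"
  proof (rule subgroupI)
    show "rat_squares \<subseteq> carrier rat_units"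
      by (auto simp: rat_squares_def rat_units_def)
    show "rat_squares \<noteq> {}"
      by (auto simp: rat_squares_def rat_units_def intro: exI[of _ 1])
  next
    fix a assume "a \<in> rat_squares"
    then obtain x where x: "x \<noteq> 0" "a = x ^ 2"
      by (auto simp: rat_squares_def rat_units_def)
    have "inv\<^bsub>rat_units\<^esub> a = inverse x ^ 2"
      using x by (simp add: inv_eq power_inverse)
    then show "inv\<^bsub>rat_units\<^esub> a \<in> rat_squares"
      using x by (auto simp: rat_squares_def rat_units_def simp del: power_inverse)
  next
    fix a b assume "a \<in> rat_squares" "b \<in> rat_squares"
    then obtain x y where "x \<noteq> 0" "a = x ^ 2" "y \<noteq> 0" "b = y ^ 2"
      by (auto simp: rat_squares_def rat_units_def)
    then have "a \<otimes>\<^bsub>rat_units\<^esub> b = (x * y) ^ 2 \<and> x * y \<noteq> 0"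
      by (simp add: rat_units_def power_mult_distrib)
    then show "a \<otimes>\<^bsub>rat_units\<^esub> b \<in> rat_squares"
      unfolding rat_squares_def rat_units_def by auto
  qed
  then show ?thesis by (rule subgroup_imp_normal)
qed

lemma comm_group_sqclass_group: "comm_group sqclass_group"
  unfolding sqclass_group_def
  using comm_group.abelian_FactGroup[OF comm_group_rat_units]
    normal_imp_subgroup[OF rat_squares_normal] by blast

end

theory Submission
  imports Defs
begin

text \<open>
  When \<open>P\<close> and \<open>Q\<close> are coprime, the Lucas sequence is a strong divisibility sequence:
  \<open>gcd (U\<^sub>m, U\<^sub>n) = \<bar>U\<^bsub>gcd(m,n)\<^esub>\<bar>\<close> (lemma \<open>gcd_lucasU\<close>).  Since \<open>U\<^sub>1 = 1\<close>, terms with coprime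
  indices are coprime, so a prime \<open>p\<close> divides at most one factor of \<open>\<Prod>\<^sub>i U\<^bsub>n\<^sub>i\<^esub>\<close>.  The exact
  power of \<open>p\<close> in that factor is then its power in \<open>A y\<^sup>2\<close>, and if the exponent is odd, \<open>p\<close>
  must divide \<open>A\<close> (lemma \<open>odd_multiplicity_coprime_factor\<close>).  Hence the squarefree part of each
  \<open>U\<^bsub>n\<^sub>i\<^esub>\<close> is composed of primes dividing \<open>A\<close>; it divides \<open>rad A\<close>, and its square class is
  a product of generators of the subgroup.

  Exponents of primes are meaningful only for nonzero integers.  By Binet's formula a term
  \<open>U\<^sub>n = 0\<close> with \<open>n > 0\<close> would force \<open>\<alpha>\<^sup>n = \<beta>\<^sup>n\<close>, which nondegeneracy forbids.
\<close>

section \<open>Lucas sequences\<close>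

lemma lucasU_add:
  "lucasU P Q (Suc (m + k)) = lucasU P Q (Suc m) * lucasU P Q (Suc k) + Q * lucasU P Q m * lucasU P Q k"
proof (induction k rule: less_induct)
  case (less k)
  show ?case
  proof (cases k)
    case (Suc j)
    show ?thesis
    proof (cases j)
      case 0
      then show ?thesis using Suc by (simp add: algebra_simps)
    next
      case (Suc i)
      then have k: "k = Suc (Suc i)" using \<open>k = Suc j\<close> by simp
      have "lucasU P Q (Suc (m + k))
          = P * lucasU P Q (Suc (m + Suc i)) + Q * lucasU P Q (Suc (m + i))"
        by (simp add: k)
      also have "\<dots> = P * (lucasU P Q (Suc m) * lucasU P Q (Suc (Suc i))
                           + Q * lucasU P Q m * lucasU P Q (Suc i))
          + Q * (lucasU P Q (Suc m) * lucasU P Q (Suc i) + Q * lucasU P Q m * lucasU P Q i)"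
        using less[of i] less[of "Suc i"] k by (simp only: lessI less_SucI)
      also have "\<dots> = lucasU P Q (Suc m) * lucasU P Q (Suc k) + Q * lucasU P Q m * lucasU P Q k"
        by (simp add: k algebra_simps)
      finally show ?thesis .
    qed
  qed simp
qed

lemma coprime_lucasU_Q:
  assumes "coprime P Q"
  shows "coprime (lucasU P Q (Suc n)) Q"
proof (induction n)
  case (Suc n)
  have "gcd Q (lucasU P Q n * Q + P * lucasU P Q (Suc n)) = gcd Q (P * lucasU P Q (Suc n))"
    by (rule gcd_add_mult)
  moreover have "coprime (P * lucasU P Q (Suc n)) Q"
    using assms Suc by simp
  ultimately show ?case
    by (simp add: coprime_iff_gcd_eq_1 gcd.commute algebra_simps)
qed simp

lemma coprime_lucasU_consecutive:
  assumes "coprime P Q"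
  shows "coprime (lucasU P Q n) (lucasU P Q (Suc n))"
proof (induction n)
  case (Suc n)
  have "gcd (lucasU P Q (Suc n)) (P * lucasU P Q (Suc n) + Q * lucasU P Q n)
      = gcd (lucasU P Q (Suc n)) (Q * lucasU P Q n)"
    by (rule gcd_add_mult)
  moreover have "coprime (lucasU P Q (Suc n)) (Q * lucasU P Q n)"
    using Suc coprime_lucasU_Q[OF assms] by (simp add: coprime_commute)
  ultimately show ?case
    by (simp add: coprime_iff_gcd_eq_1)
qed simp

lemma gcd_lucasU_add:
  assumes "coprime P Q"
  shows "gcd (lucasU P Q m) (lucasU P Q (m + k)) = gcd (lucasU P Q m) (lucasU P Q k)"
proof (cases k)
  case (Suc j)
  have "lucasU P Q (m + k)
      = (Q * lucasU P Q j) * lucasU P Q m + lucasU P Q (Suc m) * lucasU P Q k"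
    using lucasU_add[of P Q m j] Suc by (simp add: algebra_simps)
  then have "gcd (lucasU P Q m) (lucasU P Q (m + k))
      = gcd (lucasU P Q m) (lucasU P Q (Suc m) * lucasU P Q k)"
    by (simp only: gcd_add_mult)
  also have "\<dots> = gcd (lucasU P Q m) (lucasU P Q k)"
    using coprime_lucasU_consecutive[OF assms, of m]
    by (rule gcd_mult_right_left_cancel)
  finally show ?thesis .
qed simp

lemma gcd_lucasU_mod:
  assumes "coprime P Q"
  shows "gcd (lucasU P Q m) (lucasU P Q (n mod m)) = gcd (lucasU P Q m) (lucasU P Q n)"
proof -
  have "gcd (lucasU P Q m) (lucasU P Q (m * q + k)) = gcd (lucasU P Q m) (lucasU P Q k)" for q k
  proof (induction q)
    case (Suc q)
    then show ?case
      using gcd_lucasU_add[OF assms, of m "m * q + k"] by (simp add: add.assoc)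
  qed simp
  from this[of "n div m" "n mod m"] show ?thesis by simp
qed

text \<open>Strong divisibility, obtained by running the Euclidean algorithm on the indices.\<close>

lemma gcd_lucasU:
  assumes "coprime P Q"
  shows "gcd (lucasU P Q m) (lucasU P Q n) = \<bar>lucasU P Q (gcd m n)\<bar>"
proof (induction m n rule: gcd_nat_induct)
  case (step m n)
  have "gcd (lucasU P Q m) (lucasU P Q n) = gcd (lucasU P Q n) (lucasU P Q (m mod n))"
    by (simp add: gcd_lucasU_mod[OF assms] gcd.commute)
  also have "\<dots> = \<bar>lucasU P Q (gcd m n)\<bar>"
    using step by (simp only: gcd_red_nat[of m n])
  finally show ?case .
qed simp

lemma coprime_lucasU:
  assumes "coprime P Q" and "coprime m n"
  shows "coprime (lucasU P Q m) (lucasU P Q n)"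
  using gcd_lucasU[OF assms(1), of m n] assms(2) by (simp add: coprime_iff_gcd_eq_1)

text \<open>Binet's formula, free of division so that it also covers a double root.\<close>

lemma lucasU_binet:
  fixes \<alpha> \<beta> :: complex
  assumes "\<alpha> + \<beta> = of_int P" and "\<alpha> * \<beta> = - of_int Q"
  shows "(\<alpha> - \<beta>) * of_int (lucasU P Q n) = \<alpha> ^ n - \<beta> ^ n"
proof (induction n rule: less_induct)
  case (less n)
  consider "n = 0" | "n = 1" | k where "n = Suc (Suc k)"
    by (metis One_nat_def not0_implies_Suc)
  then show ?case
  proof cases
    case 3
    have "(\<alpha> - \<beta>) * of_int (lucasU P Q n)
        = of_int P * ((\<alpha> - \<beta>) * of_int (lucasU P Q (Suc k)))
          + of_int Q * ((\<alpha> - \<beta>) * of_int (lucasU P Q k))"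
      using 3 by (simp add: algebra_simps)
    also have "\<dots> = (\<alpha> + \<beta>) * (\<alpha> ^ Suc k - \<beta> ^ Suc k) - (\<alpha> * \<beta>) * (\<alpha> ^ k - \<beta> ^ k)"
      using less[of k] less[of "Suc k"] 3 assms by simp
    also have "\<dots> = \<alpha> ^ n - \<beta> ^ n"
      using 3 by (simp add: algebra_simps)
    finally show ?thesis .
  qed auto
qed

lemma lucasU_nonzero:
  assumes "lucas_nondegenerate P Q" and "Q \<noteq> 0" and "n > 0"
  shows "lucasU P Q n \<noteq> 0"
proof
  assume zero: "lucasU P Q n = 0"
  define d where "d = csqrt (of_int (P ^ 2 + 4 * Q))"
  define \<alpha> \<beta> where "\<alpha> = (of_int P + d) / 2" and "\<beta> = (of_int P - d) / 2"
  have d: "d ^ 2 = of_int P ^ 2 + 4 * of_int Q"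
    by (simp add: d_def)
  have sum: "\<alpha> + \<beta> = of_int P"
    by (simp add: \<alpha>_def \<beta>_def flip: add_divide_distrib)
  have "\<alpha> * \<beta> = (of_int P ^ 2 - d ^ 2) / 4"
    by (simp add: \<alpha>_def \<beta>_def power2_eq_square algebra_simps)
  then have prod: "\<alpha> * \<beta> = - of_int Q"
    by (simp add: d)
  have "[:- of_int Q, - of_int P, 1:] = [:- \<alpha>, 1:] * [:- \<beta>, 1:]"
    using sum prod by (simp add: algebra_simps flip: minus_add_distrib)
  then have "(\<alpha> / \<beta>) ^ n \<noteq> 1"
    using assms(1,3) unfolding lucas_nondegenerate_def by blast
  moreover have "\<alpha> ^ n = \<beta> ^ n"
    using lucasU_binet[OF sum prod, of n] zero by simp
  moreover have "\<beta> \<noteq> 0"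
    using prod assms(2) by auto
  ultimately show False
    by (simp add: power_divide)
qed

section \<open>Squarefree parts\<close>

lemma odd_multiplicity_coprime_factor:
  fixes u :: "'i \<Rightarrow> int" and A y p :: int
  assumes "finite I" and "i \<in> I" and "\<And>j. j \<in> I \<Longrightarrow> u j \<noteq> 0"
    and cop: "pairwise (\<lambda>j k. coprime (u j) (u k)) I"
    and eq: "A * y ^ 2 = (\<Prod>j\<in>I. u j)"
    and p: "prime p" "odd (multiplicity p (u i))"
  shows "p dvd A"
proof (rule ccontr)
  assume "\<not> p dvd A"
  have p_dvd: "p dvd u i"
    using p(2) not_dvd_imp_multiplicity_0[of p "u i"] by fastforce
  have "(\<Prod>j\<in>I. u j) \<noteq> 0"
    using assms(1,3) by simp
  then have nz: "A \<noteq> 0" "y \<noteq> 0"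
    using eq by auto
  have "multiplicity p (u j) = 0" if "j \<in> I - {i}" for j
  proof -
    have "coprime (u i) (u j)"
      using cop that assms(2) by (auto simp: pairwise_def)
    then have "\<not> p dvd u j"
      using p_dvd p(1) by (meson coprime_common_divisor not_prime_unit)
    then show ?thesis by (rule not_dvd_imp_multiplicity_0)
  qed
  then have "multiplicity p (\<Prod>j\<in>I. u j) = multiplicity p (u i)"
    using assms(1-3) p(1)
    by (subst prime_elem_multiplicity_prod_distrib) (auto simp: sum.remove[of I i])
  moreover have "multiplicity p (A * y ^ 2) = 2 * multiplicity p y"
    using prime_imp_prime_elem[OF p(1)] nz not_dvd_imp_multiplicity_0[OF \<open>\<not> p dvd A\<close>]
    by (subst prime_elem_multiplicity_mult_distrib)
      (auto simp: prime_elem_multiplicity_power_distrib)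
  ultimately show False
    using p(2) eq by simp
qed

lemma prime_dvd_rad:
  assumes "A \<noteq> 0" and "prime p" and "p dvd A"
  shows "p dvd rad A"
  unfolding rad_def using assms by (intro dvd_prodI) (auto simp: prime_factors_dvd)

lemma squarefree_dvd_rad:
  fixes e A :: int
  assumes "squarefree e" and "A \<noteq> 0" and "\<And>p. prime p \<Longrightarrow> p dvd e \<Longrightarrow> p dvd A"
  shows "e dvd rad A"
proof (rule multiplicity_le_imp_dvd)
  show "e \<noteq> 0" using assms(1) by auto
  fix p :: int assume p: "prime p"
  have nz: "rad A \<noteq> 0"
    by (auto simp: rad_def)
  show "multiplicity p e \<le> multiplicity p (rad A)"
  proof (cases "p dvd e")
    case True
    have "multiplicity p e \<le> 1"
      using assms(1) p \<open>e \<noteq> 0\<close> squarefree_factorial_semiring''[of e] by auto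
    also have "1 \<le> multiplicity p (rad A)"
      using prime_dvd_rad[OF assms(2) p assms(3)[OF p True]] p nz
        prime_multiplicity_gt_zero_iff[of p "rad A"] by (auto simp: Suc_le_eq)
    finally show ?thesis .
  qed (simp add: not_dvd_imp_multiplicity_0)
qed

section \<open>Square classes\<close>

lemma sqclass_mult:
  assumes "x \<noteq> 0" and "y \<noteq> 0"
  shows "sqclass (x * y) = sqclass x \<otimes>\<^bsub>sqclass_group\<^esub> sqclass y"
  using normal.rcos_sum[OF rat_squares_normal, of x y] assms
  by (simp add: sqclass_def sqclass_group_def rat_units_def)

lemma sqclass_square:
  assumes "x \<noteq> 0"
  shows "sqclass (x ^ 2) = \<one>\<^bsub>sqclass_group\<^esub>"
proof -
  have "x ^ 2 \<in> rat_squares"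
    using assms by (auto simp: rat_squares_def rat_units_def)
  then have "sqclass (x ^ 2) = rat_squares"
    unfolding sqclass_def
    using normal_imp_subgroup[OF rat_squares_normal] comm_group_rat_units
    by (simp add: group.coset_join2 comm_group.axioms(2) subgroup.mem_carrier)
  then show ?thesis
    by (simp add: sqclass_group_def)
qed

lemma sqclass_in_G_sub:
  fixes u A :: int
  assumes "u \<noteq> 0" and "\<And>p. prime p \<Longrightarrow> p dvd u \<Longrightarrow> p dvd A"
  shows "sqclass (of_int u) \<in> G_sub A"
  using assms
proof (induction u rule: prime_divisors_induct)
  case (unit u)
  then consider "u = 1" | "u = -1"
    by (auto simp: abs_if split: if_splits)
  then show ?case
  proof cases
    case 1
    then show ?thesis
      using sqclass_square[of 1] by (simp add: G_sub_def generate.one)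
  next
    case 2
    then show ?thesis
      by (auto simp: G_sub_def intro: generate.incl)
  qed
next
  case (factor p u)
  have "sqclass (of_int p) \<in> G_sub A"
    unfolding G_sub_def using factor by (intro generate.incl) auto
  moreover have "sqclass (of_int u) \<in> G_sub A"
    using factor by auto
  ultimately show ?case
    using factor.prems(1) sqclass_mult[of "of_int p" "of_int u"]
    by (simp add: G_sub_def generate.eng)
qed simp

section \<open>Products of Lucas terms with coprime indices\<close>

theorem theorem1p1:
  fixes P Q A y :: int and r :: nat and n :: "nat \<Rightarrow> nat"
  assumes "Q = 1 \<or> Q = - 1"
    and "P ^ 2 + 4 * Q > 0"
    and "lucas_nondegenerate P Q"
    and "A \<noteq> 0"
    and "r \<ge> 1"
    and "\<forall>i\<in>{1..r}. n i > 0"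
    and "pairwise (\<lambda>i j. coprime (n i) (n j)) {1..r}"
    and "A * y ^ 2 = (\<Prod>i=1..r. lucasU P Q (n i))"
  shows "(\<forall>i\<in>{1..r}. \<exists>e s :: int. squarefree e \<and> lucasU P Q (n i) = e * s ^ 2 \<and> \<bar>e\<bar> dvd rad A)
    \<and> (\<forall>i\<in>{1..r}. sqclass (of_int (lucasU P Q (n i))) \<in> G_sub A)"
proof -
  have PQ: "coprime P Q"
    using assms(1) by auto
  have nz: "lucasU P Q (n i) \<noteq> 0" if "i \<in> {1..r}" for i
    using lucasU_nonzero[OF assms(3)] assms(1,6) that by auto
  have cop: "pairwise (\<lambda>i j. coprime (lucasU P Q (n i)) (lucasU P Q (n j))) {1..r}"
    using assms(7) coprime_lucasU[OF PQ] by (auto simp: pairwise_def)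
  have main: "(\<exists>e s :: int. squarefree e \<and> lucasU P Q (n i) = e * s ^ 2 \<and> \<bar>e\<bar> dvd rad A)
      \<and> sqclass (of_int (lucasU P Q (n i))) \<in> G_sub A" if i: "i \<in> {1..r}" for i
  proof -
    \<comment> \<open>The squarefree part is the signed cofactor \<open>u div s\<^sup>2\<close>, so \<open>e\<close> has the sign of \<open>u\<close>.\<close>
    define u e s where "u = lucasU P Q (n i)" and "e = squarefree_part u" and "s = square_part u"
    have u: "u = e * s ^ 2"
      unfolding e_def s_def by (rule squarefree_decompose)
    have e: "squarefree e" "e \<noteq> 0" and s: "s \<noteq> 0"
      using nz[OF i] by (auto simp: e_def s_def u_def)
    have dvd: "p dvd A" if p: "prime p" "p dvd e" for p
    proof -
      have "multiplicity p e > 0"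
        using p e(2) prime_multiplicity_gt_zero_iff[of p e] by blast
      then have "odd (multiplicity p u)"
        using p(1) by (simp add: e_def prime_multiplicity_squarefree_part odd_iff_mod_2_eq_one)
      then show ?thesis
        using odd_multiplicity_coprime_factor[OF _ i nz cop assms(8) p(1)]
        by (simp add: u_def)
    qed
    have "\<bar>e\<bar> dvd rad A"
      using squarefree_dvd_rad[OF e(1) assms(4) dvd] by simp
    moreover have "sqclass (of_int u) \<in> G_sub A"
    proof -
      have "sqclass (of_int u)
          = sqclass (of_int e) \<otimes>\<^bsub>sqclass_group\<^esub> sqclass (of_int s ^ 2)"
        using sqclass_mult[of "of_int e" "of_int s ^ 2"] e(2) s by (simp add: u)
      then show ?thesis
        using sqclass_in_G_sub[OF e(2) dvd] sqclass_square[of "of_int s"] s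
        by (simp add: G_sub_def generate.eng generate.one)
    qed
    ultimately show ?thesis
      using e(1) u unfolding u_def[symmetric] by blast
  qed
  then show ?thesis by blast
qed

end
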